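(* The nonlinear subdivision scheme $S_{\mathrm{PPHA}}:\ell^\infty(\mathbb{Z})\to\ell^\infty(\mathbb{Z})$ is convergent, i.e. for every $f\in\ell^\infty(\mathbb{Z})$ there exists $S^\infty_{\mathrm{PPHA}}f\in C^0(\mathbb{R})$ such that $\lim_{j\to+\infty}\sup_{n\in\mathbb{Z}}|(S^j_{\mathrm{PPHA}}f)_n-S^\infty_{\mathrm{PPHA}}f(n2^{-j})|=0$. Moreover, its regularity is at least $C^{\beta-}$ with $\beta\ge-\log_2\left(\frac{7}{16}\right)>1$; that is, there is $\beta\geq -\log_2\left(\frac{7}{16}\right)$ such that $S^\infty_{\mathrm{PPHA}}f\in C^{\beta-}(\mathbb{R})$ for every $f\in\ell^\infty(\mathbb{Z})$.
   Context: For a real sequence $f=(f_n)_{n\in\mathbb{Z}}$ put $d^2f_n=f_{n+1}-2f_n+f_{n-1}$. The harmonic mean is the function $\mathrm{pph}:\mathbb{R}^2\to\mathbb{R}$ given by $\mathrm{pph}(x,y)=\frac{xy}{x+y}(\mathrm{sgn}(xy)+1)$, i.e. $\mathrm{pph}(x,y)=\frac{2xy}{x+y}$ if $xy>0$ and $\mathrm{pph}(x,y)=0$ if $xy\le 0$. The scheme $S_{\mathrm{PPHA}}$ maps a sequence $f$ to the sequence defined, for every $n\in\mathbb{Z}$, by: if $|d^2f_n|\ge|d^2f_{n+1}|$, $$(S_{\mathrm{PPHA}}f)_{2n}=\tfrac{49}{64}f_n+\tfrac{14}{64}f_{n+1}+\tfrac{1}{64}f_{n+2}-\tfrac{7}{64}\mathrm{pph}(d^2f_n,d^2f_{n+1}),$$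 $$(S_{\mathrm{PPHA}}f)_{2n+1}=\tfrac{15}{64}f_n+\tfrac{50}{64}f_{n+1}-\tfrac{1}{64}f_{n+2}-\tfrac{5}{64}\mathrm{pph}(d^2f_n,d^2f_{n+1});$$ if $|d^2f_n|<|d^2f_{n+1}|$, $$(S_{\mathrm{PPHA}}f)_{2n}=-\tfrac{1}{64}f_{n-1}+\tfrac{15}{64}f_n+\tfrac{50}{64}f_{n+1}-\tfrac{5}{64}\mathrm{pph}(d^2f_n,d^2f_{n+1}),$$ $$(S_{\mathrm{PPHA}}f)_{2n+1}=\tfrac{1}{64}f_{n-1}+\tfrac{49}{64}f_n+\tfrac{14}{64}f_{n+1}-\tfrac{7}{64}\mathrm{pph}(d^2f_n,d^2f_{n+1}).$$ $S^j_{\mathrm{PPHA}}$ denotes the $j$-fold iterate. Hölder spaces: for $0<\alpha<1$, $f\in C^\alpha(\mathbb{R})$ iff $f$ is bounded and there is $C>0$ with $|f(x)-f(y)|\le C|x-y|^\alpha$ for all $x,y\in\mathbb{R}$; for non-integer $\alpha>1$, $f\in C^\alpha(\mathbb{R})$ iff $f^{([\alpha])}$ is bounded and $f^{([\alpha])}\in C^{\alpha-[\alpha]}(\mathbb{R})$, where $[\alpha]$ is the integer part of $\alpha$. Finally $C^{\alpha-}(\mathbb{R})$ is the set of functions $f$ belonging to $C^{\gamma}(\mathbb{R})$ for all (non-integer) $0<\gamma<\alpha$.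
   Formalization: In the case |d²f_n|<|d²f_{n+1}| the coefficients of f_n and f_{n+1} are interchanged in both rules (50/64, 15/64 and 14/64, 49/64), making it the mirror image of the first case; with the printed rules the regularity claim fails. *)

theory Defs
  imports "HOL-Analysis.Analysis"
begin

definition linf :: "(int \<Rightarrow> real) set" where
  "linf = {f. bounded (range f)}"

definition d2 :: "(int \<Rightarrow> real) \<Rightarrow> int \<Rightarrow> real" where
  "d2 f n = f (n + 1) - 2 * f n + f (n - 1)"

text \<open>When \<open>x + y = 0\<close> the last factor is 0 or both arguments are 0, so the value of the
  quotient does not matter there; see \<open>pph_cases\<close> below.\<close>

definition pph :: "real \<Rightarrow> real \<Rightarrow> real" where
  "pph x y = x * y / (x + y) * (sgn (x * y) + 1)"

lemma pph_cases: "pph x y = (if x * y > 0 then 2 * x * y / (x + y) else 0)"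
  by (auto simp: pph_def sgn_if)

text \<open>The output index is written \<open>m = 2 n\<close> or \<open>m = 2 n + 1\<close> with \<open>n = m div 2\<close>
  (the integer \<open>div\<close> rounds down, also for negative \<open>m\<close>).

  In the case \<open>\<bar>d2 f n\<bar> < \<bar>d2 f (n + 1)\<bar>\<close> the rules are the mirror images
  (exchanging \<open>n\<close> with \<open>n + 1\<close> and \<open>2 n\<close> with \<open>2 n + 1\<close>) of those in the other case:
  replacing \<open>pph\<close> by the arithmetic mean then turns both cases into the same
  four-point Lagrange rules at \<open>n + 1/4\<close> and \<open>n + 3/4\<close>; see \<open>lagrange_quarter\<close> and
  \<open>lagrange_three_quarters\<close> below. This case is
  also found printed with \<open>f n\<close> and \<open>f (n + 1)\<close> interchanged; that is a misprint, since those
  rules are not exact on affine data (for \<open>f n = n\<close> they give \<open>n + 51/64\<close> and \<open>n + 13/64\<close>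
  instead of \<open>n + 1/4\<close> and \<open>n + 3/4\<close>).\<close>

definition S_PPHA :: "(int \<Rightarrow> real) \<Rightarrow> (int \<Rightarrow> real)" where
  "S_PPHA f m =
    (let n = m div 2; p = pph (d2 f n) (d2 f (n + 1)) in
     if \<bar>d2 f n\<bar> \<ge> \<bar>d2 f (n + 1)\<bar> then
       (if even m
        then 49/64 * f n + 14/64 * f (n + 1) + 1/64 * f (n + 2) - 7/64 * p
        else 15/64 * f n + 50/64 * f (n + 1) - 1/64 * f (n + 2) - 5/64 * p)
     else
       (if even m
        then - 1/64 * f (n - 1) + 50/64 * f n + 15/64 * f (n + 1) - 5/64 * p
        else 1/64 * f (n - 1) + 14/64 * f n + 49/64 * f (n + 1) - 7/64 * p))"

lemma lagrange_quarter:
  fixes f :: "int \<Rightarrow> real"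
  defines "a \<equiv> \<lambda>n. (d2 f n + d2 f (n + 1)) / 2"
  defines "L \<equiv> \<lambda>n. (- 7 * f (n - 1) + 105 * f n + 35 * f (n + 1) - 5 * f (n + 2)) / 128"
  shows "49/64 * f n + 14/64 * f (n + 1) + 1/64 * f (n + 2) - 7/64 * a n = L n"
    and "- 1/64 * f (n - 1) + 50/64 * f n + 15/64 * f (n + 1) - 5/64 * a n = L n"
  by (simp_all add: a_def L_def d2_def field_simps)

lemma lagrange_three_quarters:
  fixes f :: "int \<Rightarrow> real"
  defines "a \<equiv> \<lambda>n. (d2 f n + d2 f (n + 1)) / 2"
  defines "L \<equiv> \<lambda>n. (- 5 * f (n - 1) + 35 * f n + 105 * f (n + 1) - 7 * f (n + 2)) / 128"
  shows "15/64 * f n + 50/64 * f (n + 1) - 1/64 * f (n + 2) - 5/64 * a n = L n"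
    and "1/64 * f (n - 1) + 14/64 * f n + 49/64 * f (n + 1) - 7/64 * a n = L n"
  by (simp_all add: a_def L_def d2_def field_simps)

text \<open>\<open>F\<close> is the limit function of the scheme \<open>S\<close> started at \<open>f\<close>. The supremum is taken in
  \<open>ereal\<close> because the supremum of an unbounded set of reals is an unspecified real.\<close>

definition is_limit_function ::
    "((int \<Rightarrow> real) \<Rightarrow> (int \<Rightarrow> real)) \<Rightarrow> (int \<Rightarrow> real) \<Rightarrow> (real \<Rightarrow> real) \<Rightarrow> bool" where
  "is_limit_function S f F \<longleftrightarrow>
     continuous_on UNIV F \<and>
     (\<lambda>j. SUP n. ereal \<bar>(S ^^ j) f n - F (of_int n / 2 ^ j)\<bar>) \<longlonglongrightarrow> 0"

definition convergent_scheme :: "((int \<Rightarrow> real) \<Rightarrow> (int \<Rightarrow> real)) \<Rightarrow> bool" where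
  "convergent_scheme S \<longleftrightarrow> (\<forall>f\<in>linf. \<exists>F. is_limit_function S f F)"

text \<open>\<open>holder_small \<alpha>\<close> is meant for \<open>0 < \<alpha> < 1\<close>, \<open>holder \<alpha>\<close> for non-integer \<open>\<alpha> > 0\<close>.
  The value of \<open>deriv\<close> is unspecified where no derivative exists, so the existence of the
  derivatives up to order \<open>\<lfloor>\<alpha>\<rfloor>\<close> is required explicitly. For \<open>\<alpha> > 1\<close> only the derivative
  of order \<open>\<lfloor>\<alpha>\<rfloor>\<close> has to be bounded.\<close>

definition holder_small :: "real \<Rightarrow> (real \<Rightarrow> real) set" where
  "holder_small \<alpha> =
     {f. bounded (range f) \<and> (\<exists>C>0. \<forall>x y. \<bar>f x - f y\<bar> \<le> C * \<bar>x - y\<bar> powr \<alpha>)}"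

definition holder :: "real \<Rightarrow> (real \<Rightarrow> real) set" where
  "holder \<alpha> =
     (if \<alpha> < 1 then holder_small \<alpha>
      else {f. (\<forall>i<nat \<lfloor>\<alpha>\<rfloor>. \<forall>x. (deriv ^^ i) f differentiable at x) \<and>
               bounded (range ((deriv ^^ nat \<lfloor>\<alpha>\<rfloor>) f)) \<and>
               (deriv ^^ nat \<lfloor>\<alpha>\<rfloor>) f \<in> holder_small (\<alpha> - \<lfloor>\<alpha>\<rfloor>)})"

definition holder_minus :: "real \<Rightarrow> (real \<Rightarrow> real) set" where
  "holder_minus \<alpha> = {f. \<forall>\<gamma>. 0 < \<gamma> \<and> \<gamma> < \<alpha> \<and> \<gamma> \<notin> \<int> \<longrightarrow> f \<in> holder \<gamma>}"

end

theory Submission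
  imports Defs
begin

text \<open>The scheme is a perturbation of Chaikin's linear scheme by terms depending only on second
  differences, and bounds on the harmonic mean show that one step contracts the supremum of the
  second differences by \<open>7/16\<close>. Hence the divided differences \<open>2 ^ j * (f\<^sub>j (n + 1) - f\<^sub>j n)\<close>
  of the iterates \<open>f\<^sub>j\<close> change by \<open>O((7/8) ^ j)\<close> from one level to the next and from one index to
  the next. Viewed as step functions on the dyadic grids, they converge uniformly, at the rate
  \<open>(7/8) ^ j\<close>, to a function \<open>V\<close> which is Hoelder continuous with exponent \<open>log 2 (8/7)\<close>.
  The iterates themselves then converge at the rate \<open>2 ^ -j\<close> to a function with derivative \<open>V\<close>,
  and \<open>1 + log 2 (8/7) = - log 2 (7/16)\<close>.\<close>

section \<open>Limits of dyadically refined sequences\<close>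

lemma floor_dyadic_div2: "\<lfloor>2 ^ Suc j * x\<rfloor> div 2 = \<lfloor>2 ^ j * (x :: real)\<rfloor>"
proof -
  have "\<lfloor>2 ^ Suc j * x\<rfloor> div 2 = \<lfloor>2 ^ Suc j * x / real_of_int 2\<rfloor>"
    by (rule floor_divide_real_eq_div [symmetric]) simp
  then show ?thesis by simp
qed

lemma floor_dyadic_tendsto: "(\<lambda>j. of_int \<lfloor>2 ^ j * x\<rfloor> / 2 ^ j) \<longlonglongrightarrow> (x :: real)"
proof (rule LIM_zero_cancel, rule Lim_null_comparison)
  show "(\<lambda>j. (1 / 2 :: real) ^ j) \<longlonglongrightarrow> 0"
    by (rule LIMSEQ_power_zero) simp
  show "\<forall>\<^sub>F j in sequentially. norm (of_int \<lfloor>2 ^ j * x\<rfloor> / 2 ^ j - x) \<le> (1 / 2 :: real) ^ j"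
  proof (intro always_eventually allI)
    fix j
    have "of_int \<lfloor>2 ^ j * x\<rfloor> / 2 ^ j - x = (of_int \<lfloor>2 ^ j * x\<rfloor> - 2 ^ j * x) / 2 ^ j"
      by (simp add: field_simps)
    moreover have "\<bar>of_int \<lfloor>2 ^ j * x\<rfloor> - 2 ^ j * x\<bar> \<le> 1"
      by linarith
    ultimately show "norm (of_int \<lfloor>2 ^ j * x\<rfloor> / 2 ^ j - x) \<le> (1 / 2 :: real) ^ j"
      by (simp add: power_one_over divide_right_mono)
  qed
qed

lemma dyadic_limit_exists:
  fixes u :: "nat \<Rightarrow> int \<Rightarrow> real" and q C :: real
  assumes q: "0 < q" "q < 1"
    and refine: "\<And>j m. \<bar>u (Suc j) m - u j (m div 2)\<bar> \<le> C * q ^ j"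
    and diff: "\<And>j n. \<bar>u j (n + 1) - u j n\<bar> \<le> C * q ^ j"
  obtains G :: "real \<Rightarrow> real" and K where "K > 0" "\<And>j x. \<bar>u j \<lfloor>2 ^ j * x\<rfloor> - G x\<bar> \<le> K * q ^ j"
    "\<And>j x y. \<bar>x - y\<bar> \<le> 1 / 2 ^ j \<Longrightarrow> \<bar>G x - G y\<bar> \<le> K * q ^ j"
proof -
  define U where "U j x = u j \<lfloor>2 ^ j * x\<rfloor>" for j and x :: real
  define K where "K = C / (1 - q)"
  have C0: "0 \<le> C" using diff[of 0 0] by simp
  have K0: "0 \<le> K" using C0 q by (simp add: K_def)
  have "K * (1 - q) = C" using q by (simp add: K_def)
  then have KC: "C = K - K * q" by (simp add: algebra_simps)
  have step: "\<bar>U (Suc j) x - U j x\<bar> \<le> C * q ^ j" for j x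
    using refine[of j "\<lfloor>2 ^ Suc j * x\<rfloor>"] unfolding floor_dyadic_div2 U_def .
  have tail: "\<bar>U (j + k) x - U j x\<bar> \<le> K * q ^ j - K * q ^ (j + k)" for j k x
  proof (induction k)
    case (Suc k)
    have "C * q ^ (j + k) = K * q ^ (j + k) - K * q ^ (j + Suc k)"
      by (simp add: KC algebra_simps)
    with Suc step[of "j + k" x] show ?case by simp
  qed simp
  have tail': "\<bar>U (j + k) x - U j x\<bar> \<le> K * q ^ j" for j k x
  proof -
    have "0 \<le> K * q ^ (j + k)" using K0 q by simp
    with tail[of j k x] show ?thesis by linarith
  qed
  have q0: "(\<lambda>j. L * q ^ j) \<longlonglongrightarrow> 0" for L
    using q by (intro tendsto_mult_right_zero LIMSEQ_power_zero) simp
  have "convergent (\<lambda>j. U j x)" for x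
  proof (intro Cauchy_convergent CauchyI')
    fix e :: real assume "0 < e"
    then obtain j0 where j0: "\<bar>K * q ^ j0\<bar> < e / 2"
      using LIMSEQ_D[OF q0[of K], of "e / 2"] by auto
    have "\<bar>U m x - U n x\<bar> < e" if "j0 \<le> m" "m < n" for m n
      using tail'[of j0 "m - j0" x] tail'[of j0 "n - j0" x] j0 that by simp
    then show "\<exists>M. \<forall>m\<ge>M. \<forall>n>m. dist (U m x) (U n x) < e"
      by (auto simp: dist_real_def)
  qed
  then obtain G where G: "\<And>x. (\<lambda>j. U j x) \<longlonglongrightarrow> G x"
    unfolding convergent_def by metis
  have UG: "\<bar>U j x - G x\<bar> \<le> K * q ^ j" for j x
  proof -
    have "(\<lambda>k. U (k + j) x) \<longlonglongrightarrow> G x" using G by (rule LIMSEQ_ignore_initial_segment)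
    then have "(\<lambda>k. \<bar>U (k + j) x - U j x\<bar>) \<longlonglongrightarrow> \<bar>G x - U j x\<bar>"
      by (intro tendsto_intros)
    then have "\<bar>G x - U j x\<bar> \<le> K * q ^ j"
      by (rule LIMSEQ_le_const2) (use tail'[of j _ x] in \<open>auto simp: add.commute\<close>)
    then show ?thesis by (simp add: abs_minus_commute)
  qed
  have modulus: "\<bar>G x - G y\<bar> \<le> (2 * K + C) * q ^ j" if "\<bar>x - y\<bar> \<le> 1 / 2 ^ j" for j x y
  proof -
    have "\<bar>2 ^ j * x - 2 ^ j * y\<bar> = 2 ^ j * \<bar>x - y\<bar>"
      by (simp add: abs_mult flip: right_diff_distrib)
    also have "\<dots> \<le> 1"
      using that by (simp add: field_simps)
    finally have "\<lfloor>2 ^ j * x\<rfloor> = \<lfloor>2 ^ j * y\<rfloor> \<or> \<lfloor>2 ^ j * x\<rfloor> = \<lfloor>2 ^ j * y\<rfloor> + 1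
        \<or> \<lfloor>2 ^ j * y\<rfloor> = \<lfloor>2 ^ j * x\<rfloor> + 1"
      by linarith
    then have "\<bar>U j x - U j y\<bar> \<le> C * q ^ j"
      using diff[of j "\<lfloor>2 ^ j * x\<rfloor>"] diff[of j "\<lfloor>2 ^ j * y\<rfloor>"] C0 q
      by (auto simp: U_def abs_minus_commute)
    with UG[of j x] UG[of j y] show ?thesis
      by (simp add: algebra_simps)
  qed
  show thesis
  proof (rule that[of "2 * K + C + 1" G])
    show "2 * K + C + 1 > 0" using K0 C0 by simp
    fix j x y
    have le: "L * q ^ j \<le> (2 * K + C + 1) * q ^ j" if "L \<le> 2 * K + C + 1" for L
      using that q by (intro mult_right_mono) auto
    show "\<bar>u j \<lfloor>2 ^ j * x\<rfloor> - G x\<bar> \<le> (2 * K + C + 1) * q ^ j"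
      using UG[of j x] le[of K] K0 C0 by (simp add: U_def)
    assume "\<bar>x - y\<bar> \<le> 1 / 2 ^ j"
    from modulus[OF this] le[of "2 * K + C"]
    show "\<bar>G x - G y\<bar> \<le> (2 * K + C + 1) * q ^ j" by simp
  qed
qed

lemma dyadic_modulus_imp_continuous:
  fixes G :: "real \<Rightarrow> real"
  assumes q: "0 < q" "q < 1"
    and modulus: "\<And>j x y. \<bar>x - y\<bar> \<le> 1 / 2 ^ j \<Longrightarrow> \<bar>G x - G y\<bar> \<le> K * q ^ j"
  shows "continuous_on UNIV G"
  unfolding continuous_on_iff
proof (intro ballI allI impI)
  fix x e :: real assume "0 < e"
  have "(\<lambda>j. K * q ^ j) \<longlonglongrightarrow> 0"
    using q by (intro tendsto_mult_right_zero LIMSEQ_power_zero) simp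
  then obtain j where j: "\<bar>K * q ^ j\<bar> < e"
    using LIMSEQ_D[of _ 0 e] \<open>0 < e\<close> by force
  show "\<exists>d>0. \<forall>y\<in>UNIV. dist y x < d \<longrightarrow> dist (G y) (G x) < e"
  proof (intro exI[of _ "1 / 2 ^ j"] conjI ballI impI)
    fix y assume "dist y x < 1 / 2 ^ j"
    with modulus[of y x j] j show "dist (G y) (G x) < e"
      by (simp add: dist_real_def)
  qed simp
qed

lemma dyadic_scale_exists:
  fixes t :: real
  assumes "0 < t" "t \<le> 1"
  obtains j where "1 / 2 ^ Suc j < t" "t \<le> 1 / 2 ^ j"
proof -
  have ex: "\<exists>j. 1 / 2 ^ j < t"
    using real_arch_pow_inv[of t "1 / 2"] assms(1) by (auto simp: power_one_over)
  define i where "i = (LEAST j. 1 / 2 ^ j < t)"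
  have i: "1 / 2 ^ i < t" unfolding i_def by (rule LeastI_ex[OF ex])
  with assms obtain j where ij: "i = Suc j" by (cases i) auto
  have "\<not> 1 / 2 ^ j < t"
    using not_less_Least[of j "\<lambda>j. 1 / 2 ^ j < t"] ij i_def by simp
  with i ij show thesis by (intro that[of j]) auto
qed

lemma dyadic_modulus_imp_holder_small:
  fixes G :: "real \<Rightarrow> real"
  assumes "0 < q" "q \<le> 2 powr - a" "0 < a" "0 < K" and bdd: "bounded (range G)"
    and modulus: "\<And>j x y. \<bar>x - y\<bar> \<le> 1 / 2 ^ j \<Longrightarrow> \<bar>G x - G y\<bar> \<le> K * q ^ j"
  shows "G \<in> holder_small a"
proof -
  from bdd obtain B where B: "\<And>x. \<bar>G x\<bar> \<le> B"
    unfolding bounded_iff by auto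
  have B0: "0 \<le> B" using B[of 0] by linarith
  define L where "L = 2 * B + K * 2 powr a"
  have "0 < L" using B0 \<open>0 < K\<close> by (simp add: L_def add_nonneg_pos)
  moreover have "\<bar>G x - G y\<bar> \<le> L * \<bar>x - y\<bar> powr a" for x y
  proof (cases "\<bar>x - y\<bar> \<le> 1")
    case False
    then have "L * 1 \<le> L * \<bar>x - y\<bar> powr a"
      using \<open>0 < a\<close> \<open>0 < L\<close> by (intro mult_left_mono ge_one_powr_ge_zero) auto
    moreover have "\<bar>G x - G y\<bar> \<le> L"
      using B[of x] B[of y] \<open>0 < K\<close> by (simp add: L_def add_increasing2)
    ultimately show ?thesis by linarith
  next
    case True
    show ?thesis
    proof (cases "x = y")
      case False
      with True obtain j where j: "1 / 2 ^ Suc j < \<bar>x - y\<bar>" "\<bar>x - y\<bar> \<le> 1 / 2 ^ j"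
        using dyadic_scale_exists[of "\<bar>x - y\<bar>"] by auto
      have "(1 / 2 ^ Suc j :: real) = 2 powr - real (Suc j)"
        by (simp add: powr_minus powr_realpow field_simps del: of_nat_Suc)
      then have scale: "(2 powr - a) ^ j = 2 powr a * (1 / 2 ^ Suc j) powr a"
        by (simp add: powr_power powr_powr algebra_simps flip: powr_add)
      have "q ^ j \<le> (2 powr - a) ^ j" using assms by (intro power_mono) auto
      also have "\<dots> = 2 powr a * (1 / 2 ^ Suc j) powr a" by (rule scale)
      also have "\<dots> \<le> 2 powr a * \<bar>x - y\<bar> powr a"
        using j(1) \<open>0 < a\<close> by (intro mult_left_mono powr_mono2) auto
      finally have "K * q ^ j \<le> K * (2 powr a * \<bar>x - y\<bar> powr a)"
        using \<open>0 < K\<close> by (intro mult_left_mono) auto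
      also have "\<dots> \<le> L * \<bar>x - y\<bar> powr a"
        using B0 by (simp add: L_def algebra_simps)
      finally show ?thesis using modulus[OF j(2)] by linarith
    qed simp
  qed
  ultimately show ?thesis using bdd by (auto simp: holder_small_def)
qed

lemma dyadic_limit_bounded:
  fixes u :: "int \<Rightarrow> real"
  assumes "bounded (range u)" "\<And>x. \<bar>u \<lfloor>x\<rfloor> - G x\<bar> \<le> K"
  shows "bounded (range G)"
proof -
  from assms(1) obtain B where B: "\<And>n. \<bar>u n\<bar> \<le> B"
    unfolding bounded_iff by auto
  have "\<bar>G x\<bar> \<le> B + K" for x
    using B[of "\<lfloor>x\<rfloor>"] assms(2)[of x] by linarith
  then show ?thesis unfolding bounded_iff by auto
qed

lemma telescoping_approx:
  fixes g :: "int \<Rightarrow> real"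
  assumes "m \<le> n" "\<And>k. m \<le> k \<Longrightarrow> k < n \<Longrightarrow> \<bar>g (k + 1) - g k - c\<bar> \<le> K"
  shows "\<bar>g n - g m - of_int (n - m) * c\<bar> \<le> of_int (n - m) * K"
  using assms
proof (induction n rule: int_ge_induct)
  case (step i)
  have "\<bar>g i - g m - of_int (i - m) * c\<bar> \<le> of_int (i - m) * K"
    using step by auto
  moreover have "\<bar>g (i + 1) - g i - c\<bar> \<le> K" using step by auto
  ultimately show ?case by (simp add: algebra_simps)
qed simp

lemma has_real_derivative_straddle:
  fixes F :: "real \<Rightarrow> real"
  assumes "\<And>e. 0 < e \<Longrightarrow> \<exists>d>0. \<forall>x y. x \<le> z \<and> z \<le> y \<and> z - x < d \<and> y - z < d
      \<longrightarrow> \<bar>F y - F x - (y - x) * D\<bar> \<le> e * (y - x)"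
  shows "(F has_real_derivative D) (at z)"
  unfolding DERIV_def
proof (rule LIM_I)
  fix e :: real assume "0 < e"
  then obtain d where d: "d > 0" "\<And>x y. x \<le> z \<Longrightarrow> z \<le> y \<Longrightarrow> z - x < d \<Longrightarrow> y - z < d
      \<Longrightarrow> \<bar>F y - F x - (y - x) * D\<bar> \<le> e / 2 * (y - x)"
    using assms[of "e / 2"] by (metis half_gt_zero)
  show "\<exists>s>0. \<forall>h. h \<noteq> 0 \<and> norm (h - 0) < s \<longrightarrow> norm ((F (z + h) - F z) / h - D) < e"
  proof (intro exI[of _ d] conjI allI impI)
    fix h :: real assume h: "h \<noteq> 0 \<and> norm (h - 0) < d"
    have "\<bar>F (z + h) - F z - h * D\<bar> \<le> e / 2 * \<bar>h\<bar>"
      using d(2)[of z "z + h"] d(2)[of "z + h" z] h d(1)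
      by (cases "h > 0") (auto simp: abs_le_iff algebra_simps)
    also have "\<dots> < e * \<bar>h\<bar>" using \<open>0 < e\<close> h by simp
    finally have "\<bar>F (z + h) - F z - h * D\<bar> / \<bar>h\<bar> < e"
      using h by (simp add: pos_divide_less_eq)
    moreover have "(F (z + h) - F z) / h - D = (F (z + h) - F z - h * D) / h"
      using h by (simp add: field_simps)
    ultimately show "norm ((F (z + h) - F z) / h - D) < e"
      by simp
  qed (use d in auto)
qed

lemma dyadic_limit_has_derivative:
  fixes u :: "nat \<Rightarrow> int \<Rightarrow> real"
  assumes F: "\<And>x. (\<lambda>j. u j \<lfloor>2 ^ j * x\<rfloor>) \<longlonglongrightarrow> F x"
    and q: "0 < q" "q < 1"
    and V: "\<And>j x. \<bar>2 ^ j * (u j (\<lfloor>2 ^ j * x\<rfloor> + 1) - u j \<lfloor>2 ^ j * x\<rfloor>) - V x\<bar> \<le> K * q ^ j"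
    and cont: "continuous_on UNIV V"
  shows "(F has_real_derivative V z) (at z)"
proof (rule has_real_derivative_straddle)
  fix e :: real assume "0 < e"
  obtain d where d: "d > 0" "\<And>t. \<bar>t - z\<bar> < d \<Longrightarrow> \<bar>V t - V z\<bar> < e"
    using cont \<open>0 < e\<close> unfolding continuous_on_iff dist_real_def by (metis UNIV_I)
  show "\<exists>d>0. \<forall>x y. x \<le> z \<and> z \<le> y \<and> z - x < d \<and> y - z < d
      \<longrightarrow> \<bar>F y - F x - (y - x) * V z\<bar> \<le> e * (y - x)"
  proof (intro exI[of _ "d"] conjI allI impI)
    fix x y assume xy: "x \<le> z \<and> z \<le> y \<and> z - x < d \<and> y - z < d"
    define m n where "m j = \<lfloor>2 ^ j * x\<rfloor>" and "n j = \<lfloor>2 ^ j * y\<rfloor>" for j :: nat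
    define w where "w j = (of_int (n j) / 2 ^ j - of_int (m j) / 2 ^ j :: real)" for j
    have w: "w \<longlonglongrightarrow> y - x"
      unfolding w_def m_def n_def by (intro tendsto_diff floor_dyadic_tendsto)
    have main: "\<bar>u j (n j) - u j (m j) - w j * V z\<bar> \<le> w j * (e + K * q ^ j)"
      if close: "z - of_int (m j) / 2 ^ j < d" for j
    proof -
      have "m j \<le> n j" unfolding m_def n_def using xy by (intro floor_mono) simp
      moreover have "\<bar>u j (k + 1) - u j k - V z / 2 ^ j\<bar> \<le> (e + K * q ^ j) / 2 ^ j"
        if "m j \<le> k" "k < n j" for k
      proof -
        define t :: real where "t = of_int k / 2 ^ j"
        have fl: "\<lfloor>2 ^ j * t\<rfloor> = k" by (simp add: t_def)
        have "of_int k \<le> 2 ^ j * y" using that(2) unfolding n_def by linarith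
        then have "t \<le> y" by (simp add: t_def field_simps)
        moreover have "of_int (m j) / 2 ^ j \<le> t"
          unfolding t_def using that(1) by (intro divide_right_mono) auto
        ultimately have "\<bar>V t - V z\<bar> < e"
          using close xy by (intro d(2)) linarith
        with V[of j t] have "\<bar>2 ^ j * (u j (k + 1) - u j k) - V z\<bar> \<le> e + K * q ^ j"
          unfolding fl by linarith
        then have "\<bar>2 ^ j * (u j (k + 1) - u j k) - V z\<bar> / 2 ^ j \<le> (e + K * q ^ j) / 2 ^ j"
          by (rule divide_right_mono) simp
        moreover have "u j (k + 1) - u j k - V z / 2 ^ j
            = (2 ^ j * (u j (k + 1) - u j k) - V z) / 2 ^ j"
          by (simp add: field_simps)
        ultimately show ?thesis by simp
      qed
      ultimately have "\<bar>u j (n j) - u j (m j) - of_int (n j - m j) * (V z / 2 ^ j)\<bar>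
          \<le> of_int (n j - m j) * ((e + K * q ^ j) / 2 ^ j)"
        by (rule telescoping_approx)
      moreover have "of_int (n j - m j) * (c / 2 ^ j) = w j * c" for c
        by (simp add: w_def field_simps)
      ultimately show ?thesis by simp
    qed
    have "(\<lambda>j. K * q ^ j) \<longlonglongrightarrow> 0"
      using q by (intro tendsto_mult_right_zero LIMSEQ_power_zero) simp
    then have rhs: "(\<lambda>j. w j * (e + K * q ^ j)) \<longlonglongrightarrow> (y - x) * (e + 0)"
      by (intro tendsto_intros w)
    have lhs: "(\<lambda>j. \<bar>u j (n j) - u j (m j) - w j * V z\<bar>) \<longlonglongrightarrow> \<bar>F y - F x - (y - x) * V z\<bar>"
      unfolding m_def n_def by (intro tendsto_intros F w)
    have "(\<lambda>j. z - of_int (m j) / 2 ^ j) \<longlonglongrightarrow> z - x"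
      unfolding m_def by (intro tendsto_intros floor_dyadic_tendsto)
    then have "\<forall>\<^sub>F j in sequentially. z - of_int (m j) / 2 ^ j < d"
      by (rule order_tendstoD) (use xy in auto)
    then have "\<forall>\<^sub>F j in sequentially. \<bar>u j (n j) - u j (m j) - w j * V z\<bar> \<le> w j * (e + K * q ^ j)"
      by (rule eventually_mono) (rule main)
    from tendsto_le[OF _ rhs lhs this] show "\<bar>F y - F x - (y - x) * V z\<bar> \<le> e * (y - x)"
      by (simp add: mult.commute)
  qed (use d in auto)
qed

section \<open>The scheme in terms of second differences\<close>

lemma pph_commute: "pph x y = pph y x"
  by (simp add: pph_def ac_simps)

lemma pph_minus: "pph (- x) (- y) = - pph x y"
proof -
  have "- (2 * x * y) / (x + y) = 2 * x * y / (- x - y)"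
    by (metis minus_add_distrib minus_divide_left minus_divide_right uminus_add_conv_diff diff_conv_add_uminus)
  then show ?thesis by (auto simp: pph_cases)
qed

lemma pph_bounds_pos:
  assumes "0 < b" "b \<le> a"
  shows "b \<le> pph a b" "pph a b \<le> a" "9 * pph a b - 3 * b \<le> 6 * a" "7 * pph a b - b \<le> 6 * a"
proof -
  have p: "pph a b = 2 * a * b / (a + b)" using assms by (simp add: pph_cases)
  have s: "0 < a + b" using assms by simp
  have ab: "0 \<le> (a - b) * b" "0 \<le> (a - b) * a" "0 \<le> (a - b) * (2 * a - b)" "0 \<le> (a - b) * (6 * a - b)"
    using assms by auto
  show "b \<le> pph a b" "pph a b \<le> a"
    using s ab(1,2) unfolding p by (simp_all add: pos_le_divide_eq pos_divide_le_eq algebra_simps)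
  have "pph a b \<le> (6 * a + 3 * b) / 9"
    unfolding p using s ab(3) by (simp add: pos_divide_le_eq algebra_simps)
  then show "9 * pph a b - 3 * b \<le> 6 * a" by simp
  have "pph a b \<le> (6 * a + b) / 7"
    unfolding p using s ab(4) by (simp add: pos_divide_le_eq algebra_simps)
  then show "7 * pph a b - b \<le> 6 * a" by simp
qed

lemma pph_bounds:
  assumes "\<bar>b\<bar> \<le> \<bar>a\<bar>"
  shows "\<bar>pph a b\<bar> \<le> \<bar>a\<bar>" "\<bar>9 * pph a b - 3 * b\<bar> \<le> 6 * \<bar>a\<bar>" "\<bar>7 * pph a b - b\<bar> \<le> 6 * \<bar>a\<bar>"
proof -
  consider "a * b \<le> 0" | "0 < a" "0 < b" | "0 < - a" "0 < - b"
    by (metis linorder_not_le neg_0_less_iff_less zero_less_mult_iff)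
  then have "\<bar>pph a b\<bar> \<le> \<bar>a\<bar> \<and> \<bar>9 * pph a b - 3 * b\<bar> \<le> 6 * \<bar>a\<bar> \<and> \<bar>7 * pph a b - b\<bar> \<le> 6 * \<bar>a\<bar>"
  proof cases
    case 1
    then have "pph a b = 0" by (simp add: pph_cases)
    with assms show ?thesis by (auto simp: abs_mult)
  next
    case 2
    then show ?thesis using pph_bounds_pos[of b a] assms by auto
  next
    case 3
    then show ?thesis using pph_bounds_pos[of "- b" "- a"] assms by (auto simp: pph_minus)
  qed
  then show "\<bar>pph a b\<bar> \<le> \<bar>a\<bar>" "\<bar>9 * pph a b - 3 * b\<bar> \<le> 6 * \<bar>a\<bar>" "\<bar>7 * pph a b - b\<bar> \<le> 6 * \<bar>a\<bar>"
    by auto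
qed

text \<open>\<open>corr_even\<close> and \<open>corr_odd\<close> are the deviations (times 64) of the scheme from Chaikin's
  linear scheme, whose rules are \<open>3/4, 1/4\<close> and \<open>1/4, 3/4\<close>.\<close>

definition corr_even :: "real \<Rightarrow> real \<Rightarrow> real" where
  "corr_even a b = (if \<bar>b\<bar> \<le> \<bar>a\<bar> then b - 7 * pph a b else - (a + 5 * pph a b))"

definition corr_odd :: "real \<Rightarrow> real \<Rightarrow> real" where
  "corr_odd a b = (if \<bar>b\<bar> \<le> \<bar>a\<bar> then - (b + 5 * pph a b) else a - 7 * pph a b)"

lemma S_PPHA_even:
  "S_PPHA f (2 * n) = 3/4 * f n + 1/4 * f (n + 1) + corr_even (d2 f n) (d2 f (n + 1)) / 64"
  by (simp add: S_PPHA_def corr_even_def Let_def field_simps) (simp add: d2_def add.commute)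

lemma S_PPHA_odd:
  "S_PPHA f (2 * n + 1) = 1/4 * f n + 3/4 * f (n + 1) + corr_odd (d2 f n) (d2 f (n + 1)) / 64"
  by (simp add: S_PPHA_def corr_odd_def Let_def field_simps) (simp add: d2_def add.commute)

lemma corr_bounds:
  assumes "\<bar>a\<bar> \<le> M" "\<bar>b\<bar> \<le> M"
  shows "\<bar>corr_even a b\<bar> \<le> 6 * M" "\<bar>corr_odd a b\<bar> \<le> 6 * M"
    "\<bar>corr_odd a b - 2 * corr_even a b\<bar> \<le> 6 * M" "\<bar>corr_even a b - 2 * corr_odd a b\<bar> \<le> 6 * M"
proof -
  have "\<bar>corr_even a b\<bar> \<le> 6 * M \<and> \<bar>corr_odd a b\<bar> \<le> 6 * M \<and>
    \<bar>corr_odd a b - 2 * corr_even a b\<bar> \<le> 6 * M \<and> \<bar>corr_even a b - 2 * corr_odd a b\<bar> \<le> 6 * M"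
  proof (cases "\<bar>b\<bar> \<le> \<bar>a\<bar>")
    case True
    with pph_bounds[OF True] assms show ?thesis
      unfolding corr_even_def corr_odd_def by simp argo
  next
    case False
    then have "\<bar>a\<bar> \<le> \<bar>b\<bar>" by simp
    with pph_bounds[OF this] False assms show ?thesis
      unfolding corr_even_def corr_odd_def pph_commute[of b a] by simp argo
  qed
  then show "\<bar>corr_even a b\<bar> \<le> 6 * M" "\<bar>corr_odd a b\<bar> \<le> 6 * M"
    "\<bar>corr_odd a b - 2 * corr_even a b\<bar> \<le> 6 * M" "\<bar>corr_even a b - 2 * corr_odd a b\<bar> \<le> 6 * M"
    by auto
qed

context
  fixes f :: "int \<Rightarrow> real" and M :: real
  assumes d2_le: "\<And>n. \<bar>d2 f n\<bar> \<le> M"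
begin

lemma d2_S_PPHA_le: "\<bar>d2 (S_PPHA f) m\<bar> \<le> 7/16 * M"
proof (cases "even m")
  case True
  then obtain n where n: "m = 2 * n" by blast
  have "d2 (S_PPHA f) m = S_PPHA f (2 * n + 1) - 2 * S_PPHA f (2 * n) + S_PPHA f (2 * (n - 1) + 1)"
    by (simp add: d2_def n)
  also have "\<dots> = (16 * d2 f n + (corr_odd (d2 f n) (d2 f (n + 1)) - 2 * corr_even (d2 f n) (d2 f (n + 1)))
      + corr_odd (d2 f (n - 1)) (d2 f n)) / 64"
    unfolding S_PPHA_even S_PPHA_odd by (simp add: d2_def[of f n] field_simps)
  finally show ?thesis
    using corr_bounds(3)[OF d2_le[of n] d2_le[of "n + 1"]] corr_bounds(2)[OF d2_le[of "n - 1"] d2_le[of n]]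
      d2_le[of n] by argo
next
  case False
  then obtain n where n: "m = 2 * n + 1" by (rule oddE)
  have "d2 (S_PPHA f) m = S_PPHA f (2 * (n + 1)) - 2 * S_PPHA f (2 * n + 1) + S_PPHA f (2 * n)"
    by (simp add: d2_def n algebra_simps)
  also have "\<dots> = (16 * d2 f (n + 1) + (corr_even (d2 f n) (d2 f (n + 1)) - 2 * corr_odd (d2 f n) (d2 f (n + 1)))
      + corr_even (d2 f (n + 1)) (d2 f (n + 2))) / 64"
    unfolding S_PPHA_even S_PPHA_odd by (simp add: d2_def[of f "1 + n"] field_simps)
  finally show ?thesis
    using corr_bounds(4)[OF d2_le[of n] d2_le[of "n + 1"]] corr_bounds(1)[OF d2_le[of "n + 1"] d2_le[of "n + 2"]]
      d2_le[of "n + 1"] by argo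
qed

lemma diff_S_PPHA_approx:
  "\<bar>2 * (S_PPHA f (m + 1) - S_PPHA f m) - (f (m div 2 + 1) - f (m div 2))\<bar> \<le> M"
proof (cases "even m")
  case True
  then obtain n where n: "m = 2 * n" by blast
  have "2 * (S_PPHA f (m + 1) - S_PPHA f m) - (f (m div 2 + 1) - f (m div 2))
      = (corr_odd (d2 f n) (d2 f (n + 1)) - corr_even (d2 f n) (d2 f (n + 1))) / 32"
    unfolding n S_PPHA_even S_PPHA_odd by (simp add: field_simps)
  then show ?thesis
    using corr_bounds(1,2)[OF d2_le[of n] d2_le[of "n + 1"]] by argo
next
  case False
  then obtain n where n: "m = 2 * n + 1" by (rule oddE)
  have "2 * (S_PPHA f (m + 1) - S_PPHA f m) - (f (m div 2 + 1) - f (m div 2))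
      = 2 * (S_PPHA f (2 * (n + 1)) - S_PPHA f (2 * n + 1)) - (f (n + 1) - f n)"
    by (simp add: n algebra_simps)
  also have "\<dots> = (16 * d2 f (n + 1) + corr_even (d2 f (n + 1)) (d2 f (n + 2))
      - corr_odd (d2 f n) (d2 f (n + 1))) / 32"
    unfolding S_PPHA_even S_PPHA_odd by (simp add: d2_def[of f "1 + n"] field_simps)
  finally show ?thesis
    using corr_bounds(2)[OF d2_le[of n] d2_le[of "n + 1"]] corr_bounds(1)[OF d2_le[of "n + 1"] d2_le[of "n + 2"]]
      d2_le[of "n + 1"] by argo
qed

lemma S_PPHA_approx:
  assumes "\<And>n. \<bar>f (n + 1) - f n\<bar> \<le> L"
  shows "\<bar>S_PPHA f m - f (m div 2)\<bar> \<le> L + M"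
proof (cases "even m")
  case True
  then obtain n where n: "m = 2 * n" by blast
  have "S_PPHA f m - f (m div 2) = (f (n + 1) - f n) / 4 + corr_even (d2 f n) (d2 f (n + 1)) / 64"
    unfolding n S_PPHA_even by (simp add: field_simps)
  then show ?thesis
    using corr_bounds(1)[OF d2_le[of n] d2_le[of "n + 1"]] assms[of n] by argo
next
  case False
  then obtain n where n: "m = 2 * n + 1" by (rule oddE)
  have "S_PPHA f m - f (m div 2) = 3 * (f (n + 1) - f n) / 4 + corr_odd (d2 f n) (d2 f (n + 1)) / 64"
    unfolding n S_PPHA_odd by (simp add: field_simps)
  then show ?thesis
    using corr_bounds(2)[OF d2_le[of n] d2_le[of "n + 1"]] assms[of n] by argo
qed

end

lemma linf_bounds:
  assumes "f \<in> linf"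
  obtains B where "0 < B" "\<And>n. \<bar>f n\<bar> \<le> B" "\<And>n. \<bar>f (n + 1) - f n\<bar> \<le> 2 * B" "\<And>n. \<bar>d2 f n\<bar> \<le> 4 * B"
proof -
  from assms obtain B where B: "0 < B" "\<And>n. \<bar>f n\<bar> \<le> B"
    unfolding linf_def bounded_pos by auto
  have "\<bar>f (n + 1) - f n\<bar> \<le> 2 * B" for n
    using B(2)[of "n + 1"] B(2)[of n] by linarith
  moreover have "\<bar>d2 f n\<bar> \<le> 4 * B" for n
    using B(2)[of "n + 1"] B(2)[of n] B(2)[of "n - 1"] unfolding d2_def by linarith
  ultimately show thesis using B by (intro that)
qed

lemma S_PPHA_linf:
  assumes "f \<in> linf"
  shows "S_PPHA f \<in> linf"
proof -
  from linf_bounds[OF assms] obtain B where B: "0 < B" "\<And>n. \<bar>f n\<bar> \<le> B"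
    "\<And>n. \<bar>f (n + 1) - f n\<bar> \<le> 2 * B" "\<And>n. \<bar>d2 f n\<bar> \<le> 4 * B" by blast
  have "\<bar>S_PPHA f m\<bar> \<le> 7 * B" for m
    using S_PPHA_approx[OF B(4) B(3), of m] B(2)[of "m div 2"] by linarith
  then show ?thesis unfolding linf_def bounded_iff by auto
qed

section \<open>The limit function and its derivative\<close>

lemma is_limit_function_tendsto:
  assumes "is_limit_function S f F"
  shows "(\<lambda>j. (S ^^ j) f \<lfloor>2 ^ j * x\<rfloor>) \<longlonglongrightarrow> F x"
proof -
  define E where "E j = (SUP n. ereal \<bar>(S ^^ j) f n - F (of_int n / 2 ^ j)\<bar>)" for j
  define y where "y j = (of_int \<lfloor>2 ^ j * x\<rfloor> / 2 ^ j :: real)" for j :: nat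
  have cont: "continuous_on UNIV F" and E: "E \<longlonglongrightarrow> 0"
    using assms by (auto simp: is_limit_function_def E_def[abs_def])
  have "(\<lambda>j. ereal \<bar>(S ^^ j) f \<lfloor>2 ^ j * x\<rfloor> - F (y j)\<bar>) \<longlonglongrightarrow> 0"
  proof (rule tendsto_sandwich[OF _ _ tendsto_const E])
    show "\<forall>\<^sub>F j in sequentially. ereal \<bar>(S ^^ j) f \<lfloor>2 ^ j * x\<rfloor> - F (y j)\<bar> \<le> E j"
      unfolding E_def y_def by (intro always_eventually allI SUP_upper2[OF UNIV_I]) (rule order_refl)
  qed simp
  then have "(\<lambda>j. (S ^^ j) f \<lfloor>2 ^ j * x\<rfloor> - F (y j)) \<longlonglongrightarrow> 0"
    by (simp add: zero_ereal_def tendsto_rabs_zero_iff)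
  moreover have "(\<lambda>j. F (y j)) \<longlonglongrightarrow> F x"
    using cont floor_dyadic_tendsto[of x] unfolding y_def
    by (intro continuous_on_tendsto_compose[OF cont]) auto
  ultimately show ?thesis
    using tendsto_add by fastforce
qed

lemma is_limit_functionI:
  assumes "continuous_on UNIV F" "0 < q" "q < 1"
    and approx: "\<And>j x. \<bar>(S ^^ j) f \<lfloor>2 ^ j * x\<rfloor> - F x\<bar> \<le> K * q ^ j"
  shows "is_limit_function S f F"
  unfolding is_limit_function_def
proof (intro conjI)
  have upper: "(SUP n. ereal \<bar>(S ^^ j) f n - F (of_int n / 2 ^ j)\<bar>) \<le> ereal (K * q ^ j)" for j
  proof (rule SUP_least)
    fix n
    show "ereal \<bar>(S ^^ j) f n - F (of_int n / 2 ^ j)\<bar> \<le> ereal (K * q ^ j)"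
      using approx[of j "of_int n / 2 ^ j"] by simp
  qed
  have lower: "0 \<le> (SUP n. ereal \<bar>(S ^^ j) f n - F (of_int n / 2 ^ j)\<bar>)" for j
    by (rule SUP_upper2[of 0]) auto
  have "(\<lambda>j. K * q ^ j) \<longlonglongrightarrow> 0"
    using assms by (intro tendsto_mult_right_zero LIMSEQ_power_zero) simp
  then have "(\<lambda>j. ereal (K * q ^ j)) \<longlonglongrightarrow> 0"
    by (simp add: zero_ereal_def)
  then show "(\<lambda>j. SUP n. ereal \<bar>(S ^^ j) f n - F (of_int n / 2 ^ j)\<bar>) \<longlonglongrightarrow> 0"
    by (rule tendsto_sandwich[rotated 3]) (use upper lower in auto)
qed fact

lemma S_PPHA_limit:
  assumes "f \<in> linf"
  obtains F V K where "is_limit_function S_PPHA f F" "K > 0"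
    "bounded (range F)" "\<And>j x y. \<bar>x - y\<bar> \<le> 1 / 2 ^ j \<Longrightarrow> \<bar>F x - F y\<bar> \<le> K * (1/2) ^ j"
    "bounded (range V)" "\<And>j x y. \<bar>x - y\<bar> \<le> 1 / 2 ^ j \<Longrightarrow> \<bar>V x - V y\<bar> \<le> K * (7/8) ^ j"
    "\<And>x. (F has_real_derivative V x) (at x)"
proof -
  from linf_bounds[OF assms] obtain B where B: "0 < B" "\<And>n. \<bar>f n\<bar> \<le> B"
    "\<And>n. \<bar>f (n + 1) - f n\<bar> \<le> 2 * B" "\<And>n. \<bar>d2 f n\<bar> \<le> 4 * B" by blast
  define u where "u j = (S_PPHA ^^ j) f" for j
  define v where "v j n = 2 ^ j * (u j (n + 1) - u j n)" for j n
  have u_Suc: "u (Suc j) = S_PPHA (u j)" for j by (simp add: u_def)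
  have d2u: "\<bar>d2 (u j) n\<bar> \<le> 4 * B * (7/16) ^ j" for j n
  proof (induction j arbitrary: n)
    case (Suc j)
    show ?case using d2_S_PPHA_le[OF Suc] by (simp add: u_Suc mult.commute mult.left_commute)
  qed (use B in \<open>simp add: u_def\<close>)
  have pow: "2 ^ j * (c * (7/16) ^ j) = c * (7/8 :: real) ^ j" for c j
    by (simp add: mult.left_commute flip: power_mult_distrib)
  have v_diff: "\<bar>v j (n + 1) - v j n\<bar> \<le> 4 * B * (7/8) ^ j" for j n
  proof -
    have "v j (n + 1) - v j n = 2 ^ j * d2 (u j) (n + 1)"
      by (simp add: v_def d2_def algebra_simps)
    then have "\<bar>v j (n + 1) - v j n\<bar> = 2 ^ j * \<bar>d2 (u j) (n + 1)\<bar>"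
      by (simp add: abs_mult)
    also have "\<dots> \<le> 2 ^ j * (4 * B * (7/16) ^ j)"
      using d2u by (intro mult_left_mono) auto
    finally show ?thesis unfolding pow .
  qed
  have v_refine: "\<bar>v (Suc j) m - v j (m div 2)\<bar> \<le> 4 * B * (7/8) ^ j" for j m
  proof -
    have "v (Suc j) m - v j (m div 2) =
        2 ^ j * (2 * (u (Suc j) (m + 1) - u (Suc j) m) - (u j (m div 2 + 1) - u j (m div 2)))"
      by (simp add: v_def algebra_simps)
    then have "\<bar>v (Suc j) m - v j (m div 2)\<bar> =
        2 ^ j * \<bar>2 * (u (Suc j) (m + 1) - u (Suc j) m) - (u j (m div 2 + 1) - u j (m div 2))\<bar>"
      by (simp add: abs_mult)
    also have "\<dots> \<le> 2 ^ j * (4 * B * (7/16) ^ j)"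
      unfolding u_Suc using diff_S_PPHA_approx[OF d2u] by (intro mult_left_mono) auto
    finally show ?thesis unfolding pow .
  qed
  obtain V :: "real \<Rightarrow> real" and K2 where K2: "K2 > 0" and vV: "\<And>j x. \<bar>v j \<lfloor>2 ^ j * x\<rfloor> - V x\<bar> \<le> K2 * (7/8) ^ j"
    and V: "\<And>j x y. \<bar>x - y\<bar> \<le> 1 / 2 ^ j \<Longrightarrow> \<bar>V x - V y\<bar> \<le> K2 * (7/8) ^ j"
  proof (rule dyadic_limit_exists[OF _ _ v_refine v_diff])
    show "0 < (7/8 :: real)" "7/8 < (1 :: real)" by simp_all
  qed (rule that)
  have v0: "\<bar>v 0 n\<bar> \<le> 2 * B" for n
    using B(3)[of n] by (simp add: v_def u_def)
  then have "bounded (range (v 0))" unfolding bounded_iff by auto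
  then have V_bdd: "bounded (range V)"
    by (rule dyadic_limit_bounded[of _ _ K2]) (use vV[of 0] in auto)
  obtain C where C: "\<And>x. \<bar>V x\<bar> \<le> C" using V_bdd unfolding bounded_iff by auto
  define L where "L = C + K2"
  have u_diff: "\<bar>u j (n + 1) - u j n\<bar> \<le> L * (1/2) ^ j" for j n
  proof -
    have "\<bar>v j n - V (of_int n / 2 ^ j)\<bar> \<le> K2 * (7/8) ^ j"
      using vV[of j "of_int n / 2 ^ j"] by simp
    moreover have "K2 * (7/8) ^ j \<le> K2 * 1"
      using K2 by (intro mult_left_mono power_le_one) auto
    ultimately have "\<bar>v j n\<bar> \<le> L"
      using C[of "of_int n / 2 ^ j"] unfolding L_def by linarith
    then have "\<bar>u j (n + 1) - u j n\<bar> * 2 ^ j \<le> L"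
      by (simp add: v_def abs_mult mult.commute)
    then show ?thesis by (simp add: power_one_over pos_le_divide_eq)
  qed
  have u_refine: "\<bar>u (Suc j) m - u j (m div 2)\<bar> \<le> (L + 4 * B) * (1/2) ^ j" for j m
  proof -
    have "\<bar>u (Suc j) m - u j (m div 2)\<bar> \<le> L * (1/2) ^ j + 4 * B * (7/16) ^ j"
      unfolding u_Suc by (rule S_PPHA_approx[OF d2u u_diff])
    moreover have "4 * B * (7/16) ^ j \<le> 4 * B * (1/2) ^ j"
      using B(1) by (intro mult_left_mono power_mono) auto
    ultimately show ?thesis unfolding distrib_right by linarith
  qed
  have u_diff': "\<bar>u j (n + 1) - u j n\<bar> \<le> (L + 4 * B) * (1/2) ^ j" for j n
  proof -
    have "0 \<le> 4 * B * (1/2 :: real) ^ j" using B(1) by simp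
    with u_diff[of j n] show ?thesis unfolding distrib_right by linarith
  qed
  obtain F :: "real \<Rightarrow> real" and K1 where K1: "K1 > 0" and uF: "\<And>j x. \<bar>u j \<lfloor>2 ^ j * x\<rfloor> - F x\<bar> \<le> K1 * (1/2) ^ j"
    and F: "\<And>j x y. \<bar>x - y\<bar> \<le> 1 / 2 ^ j \<Longrightarrow> \<bar>F x - F y\<bar> \<le> K1 * (1/2) ^ j"
  proof (rule dyadic_limit_exists[OF _ _ u_refine u_diff'])
    show "0 < (1/2 :: real)" "1/2 < (1 :: real)" by simp_all
  qed (rule that)
  have "bounded (range (u 0))" using assms by (simp add: u_def linf_def)
  then have F_bdd: "bounded (range F)"
    by (rule dyadic_limit_bounded[of _ _ K1]) (use uF[of 0] in auto)
  have F_cont: "continuous_on UNIV F"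
    by (rule dyadic_modulus_imp_continuous[OF _ _ F]) auto
  have V_cont: "continuous_on UNIV V"
    by (rule dyadic_modulus_imp_continuous[OF _ _ V]) auto
  have lim: "is_limit_function S_PPHA f F"
    by (rule is_limit_functionI[OF F_cont, of "1/2" _ _ K1]) (use uF in \<open>auto simp: u_def\<close>)
  have deriv: "(F has_real_derivative V x) (at x)" for x
    by (rule dyadic_limit_has_derivative[OF is_limit_function_tendsto[OF lim, folded u_def] _ _ vV[unfolded v_def] V_cont])
      auto
  show thesis
  proof (rule that[OF lim _ F_bdd _ V_bdd _ deriv, of "K1 + K2"])
    show "0 < K1 + K2" using K1 K2 by simp
    fix j and x y :: real assume "\<bar>x - y\<bar> \<le> 1 / 2 ^ j"
    note xy = F[OF this] V[OF this]
    have "0 \<le> K2 * (1/2 :: real) ^ j" "0 \<le> K1 * (7/8 :: real) ^ j" using K1 K2 by simp_all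
    with xy show "\<bar>F x - F y\<bar> \<le> (K1 + K2) * (1/2) ^ j" "\<bar>V x - V y\<bar> \<le> (K1 + K2) * (7/8) ^ j"
      unfolding distrib_right by linarith+
  qed
qed

lemma log_7_16: "- log 2 (7/16) = 1 + log 2 (8/7 :: real)"
  using log_divide[of 2 8 7] log_divide[of 2 7 16] log_nat_power[of 2 2 3] log_nat_power[of 2 2 4]
  by simp

lemma is_limit_function_S_PPHA_holder_minus:
  assumes "f \<in> linf" "is_limit_function S_PPHA f F"
  shows "F \<in> holder_minus (- log 2 (7/16))"
proof -
  obtain F' V K where lim: "is_limit_function S_PPHA f F'" and K: "K > 0"
    and F': "bounded (range F')" "\<And>j x y. \<bar>x - y\<bar> \<le> 1 / 2 ^ j \<Longrightarrow> \<bar>F' x - F' y\<bar> \<le> K * (1/2) ^ j"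
    and V: "bounded (range V)" "\<And>j x y. \<bar>x - y\<bar> \<le> 1 / 2 ^ j \<Longrightarrow> \<bar>V x - V y\<bar> \<le> K * (7/8) ^ j"
    and deriv: "\<And>x. (F' has_real_derivative V x) (at x)"
    by (rule S_PPHA_limit[OF assms(1)], rule that)
  have FF': "F = F'"
    using LIMSEQ_unique[OF assms(2)[THEN is_limit_function_tendsto] lim[THEN is_limit_function_tendsto]]
    by (rule ext)
  have "F \<in> holder \<gamma>" if \<gamma>: "0 < \<gamma>" "\<gamma> < - log 2 (7/16)" "\<gamma> \<notin> \<int>" for \<gamma>
  proof (cases "\<gamma> < 1")
    case True
    have "2 powr - 1 \<le> (2 :: real) powr - \<gamma>" using True by (intro powr_mono) auto
    then have "1/2 \<le> (2 :: real) powr - \<gamma>" by (simp add: powr_minus)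
    then have "F \<in> holder_small \<gamma>"
      unfolding FF' by (intro dyadic_modulus_imp_holder_small[OF _ _ \<open>0 < \<gamma>\<close> K F'(1) F'(2)]) auto
    then show ?thesis using True by (simp add: holder_def)
  next
    case False
    with \<gamma>(3) have "1 < \<gamma>" by (metis Ints_1 linorder_neqE_linordered_idom)
    have "log 2 (8/7 :: real) < 1" by (subst log_less_iff) auto
    with \<gamma>(2) have "\<gamma> < 2" unfolding log_7_16 by linarith
    with \<open>1 < \<gamma>\<close> have fl: "\<lfloor>\<gamma>\<rfloor> = 1" by linarith
    have "deriv F = V"
      unfolding FF' using deriv by (auto intro: DERIV_imp_deriv)
    moreover have "F differentiable at x" for x
      unfolding FF' real_differentiable_def using deriv by blast
    moreover have "V \<in> holder_small (\<gamma> - 1)"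
    proof (rule dyadic_modulus_imp_holder_small[OF _ _ _ K V])
      have "2 powr - log 2 (8/7) \<le> (2 :: real) powr - (\<gamma> - 1)"
        using \<gamma>(2) unfolding log_7_16 by (intro powr_mono) auto
      then show "7/8 \<le> (2 :: real) powr - (\<gamma> - 1)" by (simp add: powr_minus)
    qed (use \<open>1 < \<gamma>\<close> in auto)
    ultimately show ?thesis
      using False V(1) by (simp add: holder_def fl)
  qed
  then show ?thesis by (auto simp: holder_minus_def)
qed

theorem theorem2:
  shows "S_PPHA \<in> linf \<rightarrow> linf \<and>
         convergent_scheme S_PPHA \<and>
         - log 2 (7/16) > (1 :: real) \<and>
         (\<exists>\<beta> \<ge> - log 2 (7/16) :: real.
            \<forall>f\<in>linf. \<forall>F. is_limit_function S_PPHA f F \<longrightarrow> F \<in> holder_minus \<beta>)"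
proof (intro conjI)
  show "S_PPHA \<in> linf \<rightarrow> linf" using S_PPHA_linf by blast
  show "convergent_scheme S_PPHA"
    unfolding convergent_scheme_def by (meson S_PPHA_limit)
  show "- log 2 (7/16) > (1 :: real)" unfolding log_7_16 by simp
  show "\<exists>\<beta> \<ge> - log 2 (7/16) :: real.
            \<forall>f\<in>linf. \<forall>F. is_limit_function S_PPHA f F \<longrightarrow> F \<in> holder_minus \<beta>"
    using is_limit_function_S_PPHA_holder_minus by blast
qed

end
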